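(* For every integer $n>16$, the generalized Petersen graph $GP(n,3)$ is not $\ell$-distance-balanced for any integer $\ell$ with $1\le \ell<{\rm diam}(GP(n,3))$. Moreover, $16$ is the smallest integer with this property, i.e., $16$ is the smallest integer $N$ such that for every $n>N$ the graph $GP(n,3)$ is not $\ell$-distance-balanced for any $1\le \ell<{\rm diam}(GP(n,3))$.
   Context: For a connected graph $G$ and $x,y\in V(G)$, $d_G(x,y)$ denotes the distance and ${\rm diam}(G)$ the diameter. Let $W_{xy}=\{w\in V(G): d_G(w,x)<d_G(w,y)\}$. For an integer $\ell$ with $1\le \ell\le {\rm diam}(G)$, $G$ is called $\ell$-distance-balanced if $|W_{xy}|=|W_{yx}|$ for every pair $x,y\in V(G)$ with $d_G(x,y)=\ell$. For integers $n\ge 3$ and $1\le k<n/2$, the generalized Petersen graph $GP(n,k)$ has vertex set $\{u_i: i\in\mathbb{Z}_n\}\cup\{v_i: i\in\mathbb{Z}_n\}$ and edge set $\{u_iu_{i+1}: i\in\mathbb{Z}_n\}\cup\{v_iv_{i+k}: i\in\mathbb{Z}_n\}\cup\{u_iv_i: i\in\mathbb{Z}_n\}$. *)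

theory Defs
  imports Main
begin

text \<open>A graph is given by a vertex set V and a symmetric adjacency relation E
  (E only relates vertices of V).  walk_reach E m x y: there is a walk of length m
  from x to y.\<close>

fun walk_reach :: "('a \<Rightarrow> 'a \<Rightarrow> bool) \<Rightarrow> nat \<Rightarrow> 'a \<Rightarrow> 'a \<Rightarrow> bool" where
  "walk_reach E 0 x y = (x = y)"
| "walk_reach E (Suc m) x y = (\<exists>z. walk_reach E m x z \<and> E z y)"

definition gdist :: "('a \<Rightarrow> 'a \<Rightarrow> bool) \<Rightarrow> 'a \<Rightarrow> 'a \<Rightarrow> nat" where
  "gdist E x y = (LEAST m. walk_reach E m x y)"

definition gdiam :: "'a set \<Rightarrow> ('a \<Rightarrow> 'a \<Rightarrow> bool) \<Rightarrow> nat" where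
  "gdiam V E = Max {gdist E x y | x y. x \<in> V \<and> y \<in> V}"

definition Wset :: "'a set \<Rightarrow> ('a \<Rightarrow> 'a \<Rightarrow> bool) \<Rightarrow> 'a \<Rightarrow> 'a \<Rightarrow> 'a set" where
  "Wset V E x y = {w \<in> V. gdist E w x < gdist E w y}"

definition dist_balanced :: "'a set \<Rightarrow> ('a \<Rightarrow> 'a \<Rightarrow> bool) \<Rightarrow> nat \<Rightarrow> bool" where
  "dist_balanced V E l \<longleftrightarrow>
     (\<forall>x\<in>V. \<forall>y\<in>V. gdist E x y = l \<longrightarrow> card (Wset V E x y) = card (Wset V E y x))"

text \<open>Generalized Petersen graph GP(n,k): vertex (False,i) is u_i, (True,i) is v_i,
  indices taken in {0..<n} (= Z_n).\<close>

definition gp_verts :: "nat \<Rightarrow> (bool \<times> nat) set" where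
  "gp_verts n = {(b, i). i < n}"

definition gp_adj :: "nat \<Rightarrow> nat \<Rightarrow> bool \<times> nat \<Rightarrow> bool \<times> nat \<Rightarrow> bool" where
  "gp_adj n k p q = (case p of (a, i) \<Rightarrow> case q of (b, j) \<Rightarrow>
      i < n \<and> j < n \<and>
      ((\<not> a \<and> \<not> b \<and> (j = (i + 1) mod n \<or> i = (j + 1) mod n)) \<or>
       (a \<and> b \<and> (j = (i + k) mod n \<or> i = (j + k) mod n)) \<or>
       (a \<noteq> b \<and> i = j)))"

definition gp_not_ldb_below_diam :: "nat \<Rightarrow> nat \<Rightarrow> bool" where
  "gp_not_ldb_below_diam n k \<longleftrightarrow>
     (\<forall>l. 1 \<le> l \<and> l < gdiam (gp_verts n) (gp_adj n k) \<longrightarrow>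
        \<not> dist_balanced (gp_verts n) (gp_adj n k) l)"

end

theory Submission
  imports Defs
begin

text \<open>The graph \<open>GP(n,3)\<close> is covered by the same graph with index set \<open>\<int>\<close>, where distances have
  simple closed forms \<open>D\<close>; modulo \<open>n\<close> the distance is the minimum of \<open>D\<close> over the two lifts next to \<open>0\<close>.
  Pairs \<open>u\<^sub>i, u\<^sub>k\<close> and \<open>v\<^sub>i, v\<^sub>k\<close> are exchanged by a reflection, so only the pairs \<open>u\<^sub>0, v\<^sub>i\<close> can violate
  balancedness. Let \<open>T(i) = |W(u\<^sub>0,v\<^sub>i)| - |W(v\<^sub>i,u\<^sub>0)|\<close>, a sum of signs over all vertices. Adding to the terms
  of index \<open>j\<close> those of index \<open>i - j\<close> writes \<open>2 T(i)\<close> as a sum over \<open>j\<close> of four signs. Since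
  \<open>d(v\<^sub>0,v\<^sub>j) \<le> d(u\<^sub>0,v\<^sub>j) + 1\<close>, and \<open>d(u\<^sub>0,u\<^sub>j) = d(u\<^sub>0,v\<^sub>j) + 1\<close> unless \<open>j\<close> is within \<open>2\<close> of \<open>0\<close>, each of these
  four-term sums is at most \<open>0\<close> up to a few exceptional \<open>j\<close>, and it is negative for some \<open>j\<close> with \<open>i - j\<close>
  close to \<open>j\<close>. For each \<open>\<ell>\<close> below the diameter this gives an \<open>i\<close> with \<open>d(u\<^sub>0,v\<^sub>i) = \<ell>\<close> and \<open>T(i) < 0\<close>.
  For \<open>n = 16\<close> and \<open>\<ell> = 5\<close> one is forced to take \<open>i = 8\<close>, and \<open>T(8) = 0\<close>.\<close>

subsection \<open>Distances in the infinite cover\<close>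

text \<open>With index set \<open>\<int>\<close>: \<open>spoke p = d(u\<^sub>0,v\<^sub>p)\<close>, \<open>outer p = d(u\<^sub>0,u\<^sub>p)\<close>, \<open>inner p = d(v\<^sub>0,v\<^sub>p)\<close>.
  The integer nearest to \<open>p / 3\<close> is \<open>(p + 1) div 3\<close>.\<close>
definition spoke :: "int \<Rightarrow> int" where
  "spoke p = 1 + \<bar>(p + 1) div 3\<bar> + (if 3 dvd p then 0 else 1)"

text \<open>A walk either stays among the \<open>u\<close>'s, or goes down and comes up again, which
  costs one spoke more than ending at \<open>v\<close>.\<close>

definition outer :: "int \<Rightarrow> int" where
  "outer p = min \<bar>p\<bar> (spoke p + 1)"

definition inner :: "int \<Rightarrow> int" where
  "inner p = (if 3 dvd p then spoke p - 1 else spoke p + 1)"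

text \<open>The residue 2 is written \<open>3 * m - 1\<close>, so that \<open>m\<close> is the
  integer nearest to \<open>p / 3\<close> and the values depend only on its absolute value.\<close>

lemma third_cases:
  fixes p :: int
  obtains m where "p = 3 * m" | m where "p = 3 * m + 1" | m where "p = 3 * m - 1"
proof -
  have "p mod 3 = 0 \<or> p mod 3 = 1 \<or> p mod 3 = 2" by auto
  then have "p = 3 * (p div 3) \<or> p = 3 * (p div 3) + 1 \<or> p = 3 * (p div 3 + 1) - 1"
    by presburger
  then show thesis using that by blast
qed

lemma spoke_third:
  "spoke (3 * m) = 1 + \<bar>m\<bar>"
  "spoke (3 * m + 1) = 2 + \<bar>m\<bar>"
  "spoke (3 * m - 1) = 2 + \<bar>m\<bar>"
proof -
  have "(3 * m + 1) div 3 = m" "(3 * m + 1 + 1) div 3 = m" by linarith+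
  moreover have "\<not> 3 dvd 3 * m + 1" "\<not> 3 dvd 3 * m - 1" by presburger+
  ultimately show "spoke (3 * m) = 1 + \<bar>m\<bar>" "spoke (3 * m + 1) = 2 + \<bar>m\<bar>"
    "spoke (3 * m - 1) = 2 + \<bar>m\<bar>" by (simp_all add: spoke_def)
qed

lemma inner_third:
  "inner (3 * m) = \<bar>m\<bar>"
  "inner (3 * m + 1) = 3 + \<bar>m\<bar>"
  "inner (3 * m - 1) = 3 + \<bar>m\<bar>"
proof -
  have "\<not> 3 dvd 3 * m + 1" "\<not> 3 dvd 3 * m - 1" by presburger+
  then show "inner (3 * m) = \<bar>m\<bar>" "inner (3 * m + 1) = 3 + \<bar>m\<bar>"
    "inner (3 * m - 1) = 3 + \<bar>m\<bar>" by (simp_all add: inner_def spoke_third)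
qed

lemma spoke_near_third:
  "spoke (1 + 3 * m) = 2 + \<bar>m\<bar>" "spoke (3 + 3 * m) = 1 + \<bar>m + 1\<bar>"
  "spoke (3 * m + 2) = 2 + \<bar>m + 1\<bar>" "spoke (3 * m - 2) = 2 + \<bar>m - 1\<bar>"
  "spoke (3 * m + 3) = 1 + \<bar>m + 1\<bar>" "spoke (3 * m - 3) = 1 + \<bar>m - 1\<bar>"
  "spoke (2 + 3 * m) = 2 + \<bar>m + 1\<bar>" "spoke (4 + 3 * m) = 2 + \<bar>m + 1\<bar>"
  "spoke (3 * m + 4) = 2 + \<bar>m + 1\<bar>" "spoke (3 * m - 4) = 2 + \<bar>m - 1\<bar>"
  using spoke_third[of m] spoke_third[of "m + 1"] spoke_third[of "m - 1"] by (simp_all add: algebra_simps)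

lemma inner_near_third:
  "inner (3 * m + 2) = 3 + \<bar>m + 1\<bar>" "inner (3 * m - 2) = 3 + \<bar>m - 1\<bar>"
  "inner (3 * m + 3) = \<bar>m + 1\<bar>" "inner (3 * m - 3) = \<bar>m - 1\<bar>"
  "inner (2 + 3 * m) = 3 + \<bar>m + 1\<bar>" "inner (4 + 3 * m) = 3 + \<bar>m + 1\<bar>"
  "inner (3 * m + 4) = 3 + \<bar>m + 1\<bar>" "inner (3 * m - 4) = 3 + \<bar>m - 1\<bar>"
  using inner_third[of "m + 1"] inner_third[of "m - 1"] by (simp_all add: algebra_simps)

lemmas third = spoke_third inner_third spoke_near_third inner_near_third

lemma spoke_minus [simp]: "spoke (- p) = spoke p"
proof (cases rule: third_cases[of p])
  case (1 m) then show ?thesis using spoke_third(1)[of "- m"] by (simp add: third)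
next
  case (2 m) then show ?thesis using spoke_third(3)[of "- m"] by (simp add: third)
next
  case (3 m) then show ?thesis using spoke_third(2)[of "- m"] by (simp add: third)
qed

lemma inner_minus [simp]: "inner (- p) = inner p"
  by (simp add: inner_def)

lemma outer_minus [simp]: "outer (- p) = outer p"
  by (simp add: outer_def)

text \<open>The step lemmas bound the change of a distance along one edge: outer edges shift the
  index by 1, inner edges by 3, spokes change the kind. The descent lemmas supply a neighbour closer
  to the source. Together they characterise a distance function.\<close>

lemma spoke_step1: "\<bar>spoke (p + 1) - spoke p\<bar> \<le> 1"
  by (cases rule: third_cases[of p]) (auto simp: third abs_if)

lemma spoke_step3: "\<bar>spoke (p + 3) - spoke p\<bar> \<le> 1"
  by (cases rule: third_cases[of p]) (auto simp: third abs_if)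

lemma outer_step1: "\<bar>outer (p + 1) - outer p\<bar> \<le> 1"
  using spoke_step1[of p] unfolding outer_def by linarith

lemma inner_step3: "\<bar>inner (p + 3) - inner p\<bar> \<le> 1"
  by (cases rule: third_cases[of p]) (simp_all add: third)

lemma inner_spoke: "\<bar>inner p - spoke p\<bar> \<le> 1"
  by (simp add: inner_def)

lemma spoke_lower: "3 * spoke p \<ge> \<bar>p\<bar> + 3"
  by (cases rule: third_cases[of p]) (simp_all add: third)

lemma spoke_upper: "3 * spoke p \<le> \<bar>p\<bar> + 7"
  by (cases rule: third_cases[of p]) (simp_all add: third)

lemma outer_large:
  assumes "\<bar>p\<bar> \<ge> 3" shows "outer p = spoke p + 1"
\<comment> \<open>From \<open>spoke_upper\<close>, \<open>3 * (spoke p + 1)\<close> is at most the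
  absolute value of \<open>p\<close> plus 10, hence at most three times that absolute value from 5
  on.\<close>
proof (cases "\<bar>p\<bar> \<ge> 5")
  case True then show ?thesis using spoke_upper[of p] by (simp add: outer_def)
next
  case False
  then have "p \<in> {-4, -3, 3, 4}" using assms by auto
  then show ?thesis by (auto simp: outer_def spoke_def)
qed

lemma outer_small:
  assumes "\<bar>p\<bar> \<le> 2" shows "outer p = spoke p - 1"
proof -
  have "p \<in> {-2, -1, 0, 1, 2}" using assms by auto
  then show ?thesis by (auto simp: outer_def spoke_def)
qed

lemma outer_spoke: "\<bar>outer p - spoke p\<bar> \<le> 1"
  using outer_large[of p] outer_small[of p] by linarith

lemma outer_descend:
  assumes "p \<noteq> 0"
  shows "outer (p + 1) = outer p - 1 \<or> outer (p - 1) = outer p - 1 \<or> spoke p = outer p - 1"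
proof (cases "\<bar>p\<bar> \<ge> 3")
  case True then show ?thesis by (simp add: outer_large)
next
  case False
  then have "p \<in> {-2,-1,1,2}" using assms by auto
  then show ?thesis by (auto simp: outer_def spoke_def)
qed

lemma inner_descend:
  "p = 0 \<or> inner (p + 3) = inner p - 1 \<or> inner (p - 3) = inner p - 1 \<or> spoke p = inner p - 1"
  by (cases rule: third_cases[of p]) (auto simp: third abs_if)

text \<open>Here \<open>spoke p\<close> is read as the distance from \<open>u_0\<close> to
  \<open>v_p\<close>, whose neighbours are \<open>v_(p+3)\<close>, \<open>v_(p-3)\<close> and
  \<open>u_p\<close>; \<open>spoke_descend_u\<close> reads it as the distance from
  \<open>v_0\<close> to \<open>u_p\<close>.\<close>

lemma spoke_descend_v:
  "spoke (p + 3) = spoke p - 1 \<or> spoke (p - 3) = spoke p - 1 \<or> outer p = spoke p - 1"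
proof (cases "\<bar>p\<bar> \<ge> 3")
  case True then show ?thesis
    by (cases rule: third_cases[of p]) (auto simp: third abs_if)
next
  case False then show ?thesis by (simp add: outer_small)
qed

lemma spoke_descend_u:
  "spoke (p + 1) = spoke p - 1 \<or> spoke (p - 1) = spoke p - 1 \<or> inner p = spoke p - 1"
  by (cases rule: third_cases[of p]) (simp_all add: third)

subsection \<open>Distances modulo n\<close>

definition circ :: "int \<Rightarrow> (int \<Rightarrow> int) \<Rightarrow> int \<Rightarrow> int" where
  "circ n f p = min (f (p mod n)) (f (p mod n - n))"

lemma circ_mod [simp]: "circ n f (p mod n) = circ n f p"
  by (simp add: circ_def)

lemma circ_cong: "p mod n = q mod n \<Longrightarrow> circ n f p = circ n f q"
  by (simp add: circ_def)

lemma circ_range: "0 \<le> p \<Longrightarrow> p < n \<Longrightarrow> circ n f p = min (f p) (f (p - n))"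
  by (simp add: circ_def)

lemma circ_shift: "circ n f (p - n) = circ n f p" "circ n f (p + n) = circ n f p"
  by (auto intro!: circ_cong)

lemma circ_minus:
  assumes "n > 0" "\<And>p. f (- p) = f p"
  shows "circ n f (- p) = circ n f p"
proof (cases "p mod n = 0")
  case True
  then show ?thesis by (intro circ_cong) (simp add: zmod_zminus1_eq_if)
next
  case False
  then have "(- p) mod n = n - p mod n" by (simp add: zmod_zminus1_eq_if)
  then show ?thesis
    using assms(2)[of "p mod n"] assms(2)[of "p mod n - n"]
    by (simp add: circ_def min.commute)
qed

lemma circ_lift:
  assumes "n > 0"
  obtains q where "q mod n = p mod n" "- n \<le> q" "q < n" "circ n f p = f q"
proof (cases "f (p mod n) \<le> f (p mod n - n)")
  case True
  moreover have "- n \<le> p mod n" using assms pos_mod_sign[of n p] by linarith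
  ultimately show thesis using assms by (intro that[of "p mod n"]) (simp_all add: circ_def)
next
  case False
  have "- n \<le> p mod n - n" "p mod n - n < n"
    using assms pos_mod_bound[of n p] pos_mod_sign[of n p] by linarith+
  then show thesis using False
    by (intro that[of "p mod n - n"]) (auto simp: circ_def mod_diff_right_eq)
qed

definition zdist :: "bool \<Rightarrow> bool \<Rightarrow> int \<Rightarrow> int" where
  "zdist a b = (if a = b then (if a then inner else outer) else spoke)"

lemma zdist_minus [simp]: "zdist a b (- p) = zdist a b p"
  by (simp add: zdist_def)

lemma zdist_spoke: "\<bar>zdist a b p - spoke p\<bar> \<le> 1"
  using inner_spoke[of p] outer_spoke[of p] by (simp add: zdist_def)

text \<open>For these \<open>q\<close> the left side is at most 3, except that
  \<open>inner 2 = 4\<close>. On the right \<open>spoke (q + n)\<close> is at least 4, and at least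
  5 when \<open>q = 2\<close>, and \<open>zdist\<close> differs from it by at most 1.\<close>

lemma zdist_wrap:
  assumes "n \<ge> 8" "0 \<le> q" "q \<le> 3"
  shows "zdist a b q \<le> zdist a b (q + n)"
proof -
  have "spoke (q + n) \<ge> 4"
  proof (cases "q + n = 8")
    case True then show ?thesis by (simp add: spoke_def)
  next
    case False then show ?thesis using assms spoke_lower[of "q + n"] by linarith
  qed
  then have "zdist a b (q + n) \<ge> 3 + (if q = 2 \<and> a \<and> b then 1 else 0)"
    using assms zdist_spoke[of a b "q + n"] spoke_lower[of "q + n"] by (auto split: if_splits)
  moreover have "q \<in> {0, 1, 2, 3}" using assms by auto
  then have "zdist a b q \<le> 3 + (if q = 2 \<and> a \<and> b then 1 else 0)"
    by (auto simp: zdist_def outer_def inner_def spoke_def)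
  ultimately show ?thesis by linarith
qed

text \<open>The range exceeds that of the two lifts by 3 at each end, the largest index shift along
  an edge, so the neighbours of a chosen lift are still covered.\<close>

lemma circ_zdist_le:
  assumes "n \<ge> 8" "- n - 3 \<le> q" "q < n + 3"
  shows "circ n (zdist a b) q \<le> zdist a b q"
proof -
  consider "- n - 3 \<le> q" "q < - n" | "- n \<le> q" "q < 0" | "0 \<le> q" "q < n" | "n \<le> q" "q < n + 3"
    using assms by linarith
  then show ?thesis
  proof cases
    case 1
    have "circ n (zdist a b) q = circ n (zdist a b) (- q - n)"
      by (metis assms(1) circ_minus circ_shift(1) less_le_trans zdist_minus zero_less_numeral)
    also have "\<dots> \<le> zdist a b (- q - n)"
      using 1 assms by (simp add: circ_range)
    also have "\<dots> \<le> zdist a b (- q)"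
      using zdist_wrap[of n "- q - n" a b] 1 assms by simp
    finally show ?thesis by simp
  next
    case 2
    then have "circ n (zdist a b) q = min (zdist a b (q + n)) (zdist a b q)"
      using circ_range[of "q + n" n] assms by (simp add: circ_shift)
    then show ?thesis by simp
  next
    case 3
    then show ?thesis by (simp add: circ_range)
  next
    case 4
    have "circ n (zdist a b) q = circ n (zdist a b) (q - n)"
      by (simp add: circ_shift)
    also have "\<dots> \<le> zdist a b (q - n)"
      using 4 assms by (simp add: circ_range)
    also have "\<dots> \<le> zdist a b q"
      using zdist_wrap[of n "q - n" a b] 4 assms by simp
    finally show ?thesis .
  qed
qed

definition cdist :: "int \<Rightarrow> bool \<Rightarrow> bool \<Rightarrow> int \<Rightarrow> int" where
  "cdist n a b = circ n (zdist a b)"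

text \<open>One lift \<open>q\<close> realises the distance at \<open>p\<close> and bounds all
  distances nearby; this carries the step and descent properties from the cover to the
  quotient.\<close>

lemma cdist_attained:
  assumes "n \<ge> 8"
  obtains q where "q mod n = p mod n" "cdist n a b p = zdist a b q"
    "\<And>a' b' s. \<bar>s\<bar> \<le> 3 \<Longrightarrow> cdist n a' b' (p + s) \<le> zdist a' b' (q + s)"
proof -
  obtain q where q: "q mod n = p mod n" "- n \<le> q" "q < n" "circ n (zdist a b) p = zdist a b q"
    using circ_lift[of n p "zdist a b"] assms by auto
  have "cdist n a' b' (p + s) \<le> zdist a' b' (q + s)" if "\<bar>s\<bar> \<le> 3" for a' b' s
  proof -
    have "cdist n a' b' (p + s) = cdist n a' b' (q + s)"
      unfolding cdist_def by (intro circ_cong) (metis mod_add_cong q(1))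
    then show ?thesis
      unfolding cdist_def using circ_zdist_le[of n "q + s"] that q assms by (auto simp: abs_le_iff)
  qed
  then show thesis using that q by (simp add: cdist_def)
qed

lemma cdist_cong: "p mod n = q mod n \<Longrightarrow> cdist n a b p = cdist n a b q"
  unfolding cdist_def by (rule circ_cong)

lemma cdist_mod [simp]: "cdist n a b (p mod n) = cdist n a b p"
  by (simp add: cdist_def)

lemma cdist_minus: "n > 0 \<Longrightarrow> cdist n a b (- p) = cdist n a b p"
  by (simp add: cdist_def circ_minus)

lemma zdist_nonneg: "zdist a b q \<ge> 0"
  by (auto simp: zdist_def spoke_def inner_def outer_def)

lemma zdist_eq_0_iff: "zdist a b q = 0 \<longleftrightarrow> a = b \<and> q = 0"
proof -
  have "spoke q > 0" "inner q = 0 \<longleftrightarrow> q = 0" "outer q = 0 \<longleftrightarrow> q = 0"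
    by (auto simp: spoke_def inner_def outer_def)
  then show ?thesis by (auto simp: zdist_def)
qed

lemma cdist_eq_0_iff:
  assumes "n \<ge> 8"
  shows "cdist n a b p = 0 \<longleftrightarrow> a = b \<and> p mod n = 0"
proof -
  obtain q where q: "q mod n = p mod n" "cdist n a b p = zdist a b q"
    using cdist_attained[OF assms, of p a b] by metis
  have "cdist n a b 0 = zdist a b 0" if "a = b"
    using circ_range[of 0 n "zdist a b"] assms that zdist_nonneg[of a b "- n"] zdist_eq_0_iff[of a b 0]
    by (simp add: cdist_def)
  then show ?thesis
    using q zdist_eq_0_iff[of a b q] zdist_eq_0_iff[of a b 0] cdist_cong[of p n 0 a b] by auto
qed

section \<open>Identification of the closed form with the graph distance\<close>

lemma cdist_le_step:
  assumes "n \<ge> 8" "\<bar>s\<bar> \<le> 3" "\<And>q. zdist a b' (q + s) \<le> zdist a b q + 1"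
  shows "cdist n a b' (p + s) \<le> cdist n a b p + 1"
  using cdist_attained[OF assms(1), of p a b] assms(2,3) by (metis order_trans)

lemma cdist_spoke_step:
  assumes "n \<ge> 8"
  shows "cdist n a (\<not> b) p \<le> cdist n a b p + 1"
proof -
  have "zdist a (\<not> b) q \<le> zdist a b q + 1" for q
    using inner_spoke[of q] outer_spoke[of q] by (auto simp: zdist_def abs_le_iff)
  then show ?thesis using cdist_le_step[OF assms, of 0 a "\<not> b" b p] by simp
qed

lemma cdist_cycle_step:
  assumes "n \<ge> 8" "s = (if b then 3 else 1)"
  shows "cdist n a b (p + s) \<le> cdist n a b p + 1" "cdist n a b (p - s) \<le> cdist n a b p + 1"
proof -
  have step: "\<bar>zdist a b (q + s) - zdist a b q\<bar> \<le> 1" for q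
    using assms(2) spoke_step1 spoke_step3 inner_step3 outer_step1 by (auto simp: zdist_def)
  have "zdist a b (q + s) \<le> zdist a b q + 1" "zdist a b (q - s) \<le> zdist a b q + 1" for q
    using step[of q] step[of "q - s"] by (simp_all add: abs_le_iff)
  then show "cdist n a b (p + s) \<le> cdist n a b p + 1" "cdist n a b (p - s) \<le> cdist n a b p + 1"
    using cdist_le_step[OF assms(1), of s a b b p] cdist_le_step[OF assms(1), of "- s" a b b p] assms(2)
    by auto
qed

lemma cdist_descend:
  assumes "n \<ge> 8" "cdist n a b p > 0" "s = (if b then 3 else 1)"
  shows "cdist n a b (p + s) \<le> cdist n a b p - 1 \<or> cdist n a b (p - s) \<le> cdist n a b p - 1
    \<or> cdist n a (\<not> b) p \<le> cdist n a b p - 1"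
proof -
  obtain q where q: "cdist n a b p = zdist a b q"
    "\<And>a' b' s. \<bar>s\<bar> \<le> 3 \<Longrightarrow> cdist n a' b' (p + s) \<le> zdist a' b' (q + s)"
    using cdist_attained[OF assms(1), of p a b] by metis
  have "a \<noteq> b \<or> q \<noteq> 0" using q(1) assms(2) zdist_eq_0_iff[of a b q] by auto
  then have "zdist a b (q + s) = zdist a b q - 1 \<or> zdist a b (q - s) = zdist a b q - 1
    \<or> zdist a (\<not> b) q = zdist a b q - 1"
  proof (cases "a = b")
    case True
    then show ?thesis
      using \<open>a \<noteq> b \<or> q \<noteq> 0\<close> outer_descend[of q] inner_descend[of q] assms(3)
      by (cases b) (simp_all add: zdist_def)
  next
    case False
    then show ?thesis
      using spoke_descend_u[of q] spoke_descend_v[of q] assms(3) by (cases b) (simp_all add: zdist_def)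
  qed
  moreover have "cdist n a b (p + s) \<le> zdist a b (q + s)" "cdist n a b (p - s) \<le> zdist a b (q - s)"
    "cdist n a (\<not> b) p \<le> zdist a (\<not> b) q"
    using q(2)[of s a b] q(2)[of "- s" a b] q(2)[of 0 a "\<not> b"] assms(3) by auto
  ultimately show ?thesis unfolding q(1) by linarith
qed

text \<open>The step bound gives the lower bound by induction on the walk; repeated descent builds a
  walk of length \<open>f y\<close>.\<close>

lemma gdist_eqI:
  fixes f :: "'a \<Rightarrow> int"
  assumes base: "\<And>y. y \<in> V \<Longrightarrow> f y = 0 \<longleftrightarrow> y = x" and "x \<in> V"
    and nonneg: "\<And>y. f y \<ge> 0"
    and step: "\<And>y z. E y z \<Longrightarrow> f z \<le> f y + 1"
    and descend: "\<And>y. y \<in> V \<Longrightarrow> f y > 0 \<Longrightarrow> \<exists>z\<in>V. E z y \<and> f z \<le> f y - 1"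
    and "y \<in> V"
  shows "int (gdist E x y) = f y"
proof -
  have lower: "f z \<le> int m" if "walk_reach E m x z" for m z
    using that
  proof (induction m arbitrary: z)
    case 0 then show ?case using base[of x] \<open>x \<in> V\<close> by simp
  next
    case (Suc m)
    then obtain w where "walk_reach E m x w" "E w z" by auto
    then show ?case using Suc.IH step by fastforce
  qed
  have upper: "walk_reach E m x z" if "z \<in> V" "f z = int m" for m z
    using that
  proof (induction m arbitrary: z)
    case 0 then show ?case using base by simp
  next
    case (Suc m)
    then obtain w where "w \<in> V" "E w z" "f w \<le> f z - 1" using descend[of z] by auto
    moreover have "f w = int m" using step[OF \<open>E w z\<close>] \<open>f w \<le> f z - 1\<close> Suc.prems by simp
    ultimately show ?case using Suc.IH by auto
  qed
  have "walk_reach E (nat (f y)) x y" using upper[of y "nat (f y)"] nonneg \<open>y \<in> V\<close> by simp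
  moreover have "nat (f y) \<le> m" if "walk_reach E m x y" for m using lower[OF that] by simp
  ultimately have "gdist E x y = nat (f y)" unfolding gdist_def by (intro Least_equality) auto
  then show ?thesis using nonneg by simp
qed

lemma gp_adj_iff:
  "gp_adj n 3 (a, i) (b, j) \<longleftrightarrow> i < n \<and> j < n \<and>
    (if a = b then j = (i + (if b then 3 else 1)) mod n \<or> i = (j + (if b then 3 else 1)) mod n
     else i = j)"
  by (auto simp: gp_adj_def)

lemma cdist_nonneg: "cdist n a b p \<ge> 0"
  using zdist_nonneg by (simp add: cdist_def circ_def)

lemma gdist_gp:
  assumes "n \<ge> 8" "i < n" "j < n"
  shows "int (gdist (gp_adj n 3) (a, i) (b, j)) = cdist (int n) a b (int j - int i)"
proof -
  define f where "f = (\<lambda>(b, j). cdist (int n) a b (int j - int i))"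
  have n: "int n \<ge> 8" using assms by simp
  have shift: "cdist (int n) a b (int ((k + s) mod n) - int i) = cdist (int n) a b (int k - int i + int s)" for b k s
    by (rule cdist_cong) (simp add: zmod_int mod_diff_left_eq algebra_simps)
  have "int (gdist (gp_adj n 3) (a, i) (b, j)) = f (b, j)"
  proof (rule gdist_eqI[where V = "gp_verts n"])
    show "f y = 0 \<longleftrightarrow> y = (a, i)" if yV: "y \<in> gp_verts n" for y
    proof -
      obtain c k where y: "y = (c, k)" "k < n" using yV by (cases y) (auto simp: gp_verts_def)
      have "(int k - int i) mod int n = 0 \<longleftrightarrow> k = i"
      proof
        assume "(int k - int i) mod int n = 0"
        then have "int k mod int n = int i mod int n" using mod_eq_dvd_iff by blast
        then show "k = i" using y assms by simp
      qed simp
      then show ?thesis using cdist_eq_0_iff[OF n] y by (auto simp: f_def)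
    qed
    show "f y \<ge> 0" for y by (cases y) (simp add: f_def cdist_nonneg)
    show "f z \<le> f y + 1" if yz_adj: "gp_adj n 3 y z" for y z
    proof -
      obtain c k d l where yz: "y = (c, k)" "z = (d, l)" by (cases y, cases z)
      define s :: nat where "s = (if d then 3 else 1)"
      have s: "int s = (if d then 3 else 1)" by (simp add: s_def)
      consider "c = d" "l = (k + s) mod n" | "c = d" "k = (l + s) mod n" | "c = (\<not> d)" "k = l"
        using yz_adj unfolding yz gp_adj_iff s_def by (auto split: if_splits)
      then show ?thesis
      proof cases
        case 1
        then show ?thesis
          using shift[of d k s] cdist_cycle_step(1)[OF n s, of a "int k - int i"]
          by (simp add: yz f_def)
      next
        case 2
        then show ?thesis
          using shift[of d l s] cdist_cycle_step(2)[OF n s, of a "int l - int i + int s"]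
          by (simp add: yz f_def)
      next
        case 3
        then show ?thesis
          using cdist_spoke_step[OF n, of a "\<not> d" "int l - int i"] by (simp add: yz f_def)
      qed
    qed
    show "\<exists>z\<in>gp_verts n. gp_adj n 3 z y \<and> f z \<le> f y - 1" if yV: "y \<in> gp_verts n" and pos: "f y > 0" for y
    proof -
      obtain c k where y: "y = (c, k)" "k < n" using yV by (cases y) (auto simp: gp_verts_def)
      define s :: nat where "s = (if c then 3 else 1)"
      have s: "s \<le> n" "int s = (if c then 3 else 1)" using assms by (simp_all add: s_def)
      consider "cdist (int n) a c (int k - int i + int s) \<le> f y - 1" | "cdist (int n) a c (int k - int i - int s) \<le> f y - 1"
        | "cdist (int n) a (\<not> c) (int k - int i) \<le> f y - 1"
        using cdist_descend[OF n, of a c "int k - int i" "int s"] pos y s(2) by (auto simp: f_def)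
      then show ?thesis
      proof cases
        case 1
        have "gp_adj n 3 (c, (k + s) mod n) (c, k)" using y assms(1) by (auto simp: gp_adj_iff s_def)
        then show ?thesis using 1 y assms(1) shift[of c k s]
          by (intro bexI[of _ "(c, (k + s) mod n)"]) (auto simp: f_def gp_verts_def)
      next
        case 2
        \<comment> \<open>The predecessor \<open>k - s\<close> is written \<open>k + (n - s)\<close>
          to stay in the natural numbers.\<close>
        have "(k + (n - s) + s) mod n = k" using y s by simp
        then have "gp_adj n 3 (c, (k + (n - s)) mod n) (c, k)"
          using y assms(1) mod_add_left_eq[of "k + (n - s)" n s] by (simp add: gp_adj_iff s_def)
        moreover have "cdist (int n) a c (int k - int i + int (n - s)) = cdist (int n) a c (int k - int i - int s)"
          using s by (intro cdist_cong) (simp add: of_nat_diff mod_eq_dvd_iff)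
        ultimately show ?thesis using 2 y assms(1) shift[of c k "n - s"]
          by (intro bexI[of _ "(c, (k + (n - s)) mod n)"]) (auto simp: f_def gp_verts_def)
      next
        case 3
        then show ?thesis using y
          by (intro bexI[of _ "(\<not> c, k)"]) (auto simp: f_def gp_verts_def gp_adj_iff)
      qed
    qed
  qed (use assms in \<open>auto simp: gp_verts_def\<close>)
  then show ?thesis by (simp add: f_def)
qed

subsection \<open>Counting by signs\<close>

lemma card_Wset_diff:
  assumes "finite V"
  shows "int (card (Wset V E x y)) - int (card (Wset V E y x)) =
    (\<Sum>w\<in>V. sgn (int (gdist E w y) - int (gdist E w x)))"
proof -
  have "(\<Sum>w\<in>V. sgn (int (gdist E w y) - int (gdist E w x))) =
    (\<Sum>w\<in>V. (if gdist E w x < gdist E w y then 1 else 0) - (if gdist E w y < gdist E w x then 1 else 0))"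
    by (intro sum.cong) auto
  also have "\<dots> = int (card (Wset V E x y)) - int (card (Wset V E y x))"
    using assms by (simp add: sum_subtractf sum.If_cases Wset_def Int_def)
  finally show ?thesis by simp
qed

lemma finite_gp_verts: "finite (gp_verts n)"
proof -
  have "gp_verts n = UNIV \<times> {..<n}" by (auto simp: gp_verts_def)
  then show ?thesis by simp
qed

lemma card_Wset_diff_gp:
  assumes "n \<ge> 8" "i < n" "k < n"
  shows "int (card (Wset (gp_verts n) (gp_adj n 3) (a, i) (b, k))) -
      int (card (Wset (gp_verts n) (gp_adj n 3) (b, k) (a, i))) =
    (\<Sum>j = 0..<int n. \<Sum>c\<in>UNIV.
      sgn (cdist (int n) c b (int k - j) - cdist (int n) c a (int i - j)))"
proof -
  have "gp_verts n = UNIV \<times> {..<n}" (is "_ = ?V")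
    by (auto simp: gp_verts_def)
  have "int (card (Wset (gp_verts n) (gp_adj n 3) (a, i) (b, k))) -
      int (card (Wset (gp_verts n) (gp_adj n 3) (b, k) (a, i))) =
      (\<Sum>(c, j)\<in>?V. sgn (cdist (int n) c b (int k - int j) - cdist (int n) c a (int i - int j)))"
    unfolding card_Wset_diff[OF finite_gp_verts]
  proof (rule sum.cong)
    fix w assume "w \<in> ?V"
    then obtain c j where "w = (c, j)" "j < n" by auto
    then show "sgn (int (gdist (gp_adj n 3) w (b, k)) - int (gdist (gp_adj n 3) w (a, i))) =
      (case w of (c, j) \<Rightarrow> sgn (cdist (int n) c b (int k - int j) - cdist (int n) c a (int i - int j)))"
      using assms by (simp add: gdist_gp)
  qed fact
  also have "\<dots> = (\<Sum>j<n. \<Sum>c\<in>UNIV. sgn (cdist (int n) c b (int k - int j) - cdist (int n) c a (int i - int j)))"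
    by (subst sum.swap) (simp add: sum.cartesian_product)
  also have "\<dots> = (\<Sum>j = 0..<int n. \<Sum>c\<in>UNIV.
      sgn (cdist (int n) c b (int k - j) - cdist (int n) c a (int i - j)))"
    by (rule sum.reindex_bij_witness[of _ nat int]) auto
  finally show ?thesis .
qed

lemma sum_periodic_reflect:
  fixes h :: "int \<Rightarrow> 'a :: comm_monoid_add"
  assumes "n > 0" "\<And>p. h (p mod n) = h p"
  shows "(\<Sum>p = 0..<n. h (s - p)) = (\<Sum>p = 0..<n. h p)"
proof -
  have "(s - (s - p) mod n) mod n = p" if "0 \<le> p" "p < n" for p
    using that by (simp add: mod_diff_right_eq)
  then show ?thesis
    using assms by (intro sum.reindex_bij_witness[of _ "\<lambda>p. (s - p) mod n" "\<lambda>p. (s - p) mod n"]) auto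
qed

lemma sum_periodic_shift:
  fixes h :: "int \<Rightarrow> 'a :: comm_monoid_add"
  assumes "n > 0" "\<And>p. h (p mod n) = h p"
  shows "(\<Sum>p = 0..<n. h (p + s)) = (\<Sum>p = 0..<n. h p)"
proof (rule sum.reindex_bij_witness[of _ "\<lambda>p. (p - s) mod n" "\<lambda>p. (p + s) mod n"])
  fix p assume "p \<in> {0..<n}"
  then show "((p - s) mod n + s) mod n = p" "((p + s) mod n - s) mod n = p"
    by (simp_all add: mod_add_left_eq mod_diff_left_eq)
qed (use assms in auto)

text \<open>This is \<open>T(i)\<close>: the first sign belongs to the vertex \<open>u_j\<close>,
  the second to \<open>v_j\<close>.\<close>

definition bias :: "int \<Rightarrow> int \<Rightarrow> int" where
  "bias n i = (\<Sum>j = 0..<n. sgn (circ n spoke (i - j) - circ n outer j) +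
    sgn (circ n inner (i - j) - circ n spoke j))"

lemma bias_mod: "bias n (i mod n) = bias n i"
proof -
  have "circ n f (i mod n - j) = circ n f (i - j)" for f j
    by (rule circ_cong) (simp add: mod_diff_left_eq)
  then show ?thesis by (simp add: bias_def)
qed

text \<open>Rotation by \<open>i\<close> moves the pair to \<open>u_0\<close> and
  \<open>v_(k-i)\<close>.\<close>

lemma card_Wset_diff_mixed:
  assumes "n \<ge> 8" "i < n" "k < n"
  shows "int (card (Wset (gp_verts n) (gp_adj n 3) (False, i) (True, k))) -
      int (card (Wset (gp_verts n) (gp_adj n 3) (True, k) (False, i))) = bias (int n) (int k - int i)"
proof -
  define N where "N = int n"
  define h where "h j = sgn (circ N spoke (int k - j) - circ N outer (int i - j)) +
      sgn (circ N inner (int k - j) - circ N spoke (int i - j))" for j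
  have N: "N > 0" using assms by (simp add: N_def)
  have "h (j mod N) = h j" for j
  proof -
    have "circ N f (m - j mod N) = circ N f (m - j)" for f m
      by (rule circ_cong) (simp add: mod_diff_right_eq)
    then show ?thesis by (simp add: h_def)
  qed
  then have "(\<Sum>j = 0..<N. h j) = (\<Sum>j = 0..<N. h (j + int i))"
    using sum_periodic_shift[OF N] by metis
  also have "\<dots> = bias N (int k - int i)"
    unfolding bias_def h_def using circ_minus[OF N, of outer] circ_minus[OF N, of spoke]
    by (simp add: algebra_simps)
  finally show ?thesis
    unfolding card_Wset_diff_gp[OF assms]
    by (simp add: UNIV_bool cdist_def zdist_def h_def N_def algebra_simps)
qed

text \<open>The reflection of \<open>j\<close> to \<open>i + k - j\<close> negates every term of the
  sign sum, so the sum equals its own negative.\<close>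

lemma card_Wset_same_kind:
  assumes "n \<ge> 8" "i < n" "k < n"
  shows "card (Wset (gp_verts n) (gp_adj n 3) (a, i) (a, k)) =
      card (Wset (gp_verts n) (gp_adj n 3) (a, k) (a, i))"
proof -
  define N where "N = int n"
  define h where "h j = (\<Sum>c\<in>UNIV. sgn (cdist N c a (int k - j) - cdist N c a (int i - j)))" for j
  have N: "N > 0" using assms by (simp add: N_def)
  have "h (j mod N) = h j" for j
  proof -
    have "cdist N c a (m - j mod N) = cdist N c a (m - j)" for c m
      by (rule cdist_cong) (simp add: mod_diff_right_eq)
    then show ?thesis by (simp add: h_def)
  qed
  then have reflect: "(\<Sum>j = 0..<N. h j) = (\<Sum>j = 0..<N. h (int i + int k - j))"
    using sum_periodic_reflect[OF N] by metis
  have "h (int i + int k - j) = - h j" for j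
  proof -
    have "cdist N c a (int k - (int i + int k - j)) = cdist N c a (int i - j)"
      "cdist N c a (int i - (int i + int k - j)) = cdist N c a (int k - j)" for c
      using cdist_minus[OF N, of c a "int i - j"] cdist_minus[OF N, of c a "int k - j"] by simp_all
    then have "h (int i + int k - j) = (\<Sum>c\<in>UNIV. sgn (cdist N c a (int i - j) - cdist N c a (int k - j)))"
      by (simp add: h_def)
    also have "\<dots> = (\<Sum>c\<in>UNIV. - sgn (cdist N c a (int k - j) - cdist N c a (int i - j)))"
      by (intro sum.cong) (auto simp: sgn_if)
    finally show ?thesis by (simp add: h_def sum_negf)
  qed
  then have "(\<Sum>j = 0..<N. h (int i + int k - j)) = - (\<Sum>j = 0..<N. h j)" by (simp add: sum_negf)
  with reflect have "(\<Sum>j = 0..<N. h j) = 0" by simp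
  then show ?thesis using card_Wset_diff_gp[OF assms, of a a] by (simp add: h_def N_def)
qed

lemma not_dist_balancedI:
  assumes "n \<ge> 8" "0 \<le> i" "i < int n" "circ (int n) spoke i = int l" "bias (int n) i \<noteq> 0"
  shows "\<not> dist_balanced (gp_verts n) (gp_adj n 3) l"
proof -
  define k where "k = nat i"
  have k: "k < n" "int k = i" using assms by (simp_all add: k_def)
  then have "gdist (gp_adj n 3) (False, 0) (True, k) = l"
    using gdist_gp[of n 0 k False True] assms by (simp add: cdist_def zdist_def)
  moreover have "card (Wset (gp_verts n) (gp_adj n 3) (False, 0) (True, k)) \<noteq>
      card (Wset (gp_verts n) (gp_adj n 3) (True, k) (False, 0))"
    using card_Wset_diff_mixed[of n 0 k] assms k by auto
  ultimately show ?thesis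
    using k assms unfolding dist_balanced_def gp_verts_def by fastforce
qed

subsection \<open>Folding the sum by reflection\<close>

text \<open>The letters \<open>a\<close>, \<open>b\<close>, \<open>c\<close> stand for the outer,
  inner and spoke distances at \<open>j\<close>, the primed ones for those at \<open>i - j\<close>;
  the value is the term of \<open>T(i)\<close> at \<open>j\<close> plus that at
  \<open>i - j\<close>.\<close>

definition excess :: "int \<Rightarrow> int \<Rightarrow> int \<Rightarrow> int \<Rightarrow> int \<Rightarrow> int \<Rightarrow> int" where
  "excess a b c a' b' c' = sgn (c' - a) + sgn (c - a') + sgn (b' - c) + sgn (b - c')"

lemma excess_commute: "excess a b c a' b' c' = excess a' b' c' a b c"
  by (simp add: excess_def)

lemma excess_mono:
  assumes "b \<le> B" "b' \<le> B'"
  shows "excess a b c a' b' c' \<le> excess a B c a' B' c'"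
proof -
  have "sgn (b' - c) \<le> sgn (B' - c)" "sgn (b - c') \<le> sgn (B - c')"
    using assms by (auto simp: sgn_if)
  then show ?thesis by (simp add: excess_def)
qed

text \<open>At the extreme values \<open>b = c + 1\<close> and \<open>b' = c' + 1\<close> the four
  signs cancel in pairs.\<close>

lemma excess_nonpos_far:
  assumes "b \<le> c + 1" "b' \<le> c' + 1"
  shows "excess (c + 1) b c (c' + 1) b' c' \<le> 0"
proof -
  have "excess (c + 1) b c (c' + 1) b' c' \<le> excess (c + 1) (c + 1) c (c' + 1) (c' + 1) c'"
    using assms by (rule excess_mono)
  also have "\<dots> \<le> 0" by (auto simp: excess_def sgn_if)
  finally show ?thesis .
qed

text \<open>If \<open>c'\<close> is at least \<open>c + 2\<close>, the second and fourth signs are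
  -1. Otherwise \<open>c'\<close> is \<open>c\<close> or \<open>c + 1\<close> and the second sign is
  -1 by \<open>a' > c'\<close>; for \<open>c' = c\<close> the third is -1 as well, for
  \<open>c' = c + 1\<close> the last two are at most 0.\<close>

lemma excess_nonpos_near:
  assumes "b \<le> c + 1" "b' \<le> c' + 1" "a' \<ge> c' - 1"
    "c' \<ge> c + 2 \<or> c' \<ge> c \<and> b' < c' \<and> a' > c'"
  shows "excess (c - 1) b c a' b' c' \<le> 0"
  using assms unfolding excess_def sgn_if by (smt (verit))

definition gain :: "int \<Rightarrow> int \<Rightarrow> int \<Rightarrow> int" where
  "gain n i j = excess (circ n outer j) (circ n inner j) (circ n spoke j)
     (circ n outer (i - j)) (circ n inner (i - j)) (circ n spoke (i - j))"

lemma gain_commute: "gain n i (i - j) = gain n i j"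
  unfolding gain_def by (subst excess_commute) simp

lemma gain_cong:
  assumes "i mod n = i' mod n" "j mod n = j' mod n"
  shows "gain n i j = gain n i' j'"
proof -
  have "circ n f j = circ n f j'" "circ n f (i - j) = circ n f (i' - j')" for f
    using assms by (auto intro!: circ_cong mod_diff_cong)
  then show ?thesis by (simp add: gain_def)
qed

lemma double_bias:
  assumes "n > 0"
  shows "2 * bias n i = (\<Sum>j = s..<s + n. gain n i j)"
proof -
  define h where "h j = sgn (circ n spoke (i - j) - circ n outer j) +
    sgn (circ n inner (i - j) - circ n spoke j)" for j
  have mod: "circ n f (i - j mod n) = circ n f (i - j)" for f j
    by (rule circ_cong) (simp add: mod_diff_right_eq)
  have "(\<Sum>j = 0..<n. h (i - j)) = (\<Sum>j = 0..<n. h j)"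
    using assms by (rule sum_periodic_reflect) (simp add: h_def mod)
  then have "2 * bias n i = (\<Sum>j = 0..<n. h j + h (i - j))"
    by (simp add: bias_def h_def[symmetric] sum.distrib)
  also have "\<dots> = (\<Sum>j = 0..<n. gain n i j)"
    by (intro sum.cong) (simp_all add: h_def gain_def excess_def)
  also have "\<dots> = (\<Sum>j = 0..<n. gain n i (j + s))"
    using assms by (rule sum_periodic_shift[symmetric]) (auto intro: gain_cong)
  also have "\<dots> = (\<Sum>j = s..<s + n. gain n i j)"
    by (rule sum.reindex_bij_witness[of _ "\<lambda>j. j - s" "\<lambda>j. j + s"]) auto
  finally show ?thesis .
qed

section \<open>Evaluation modulo n without reduction\<close>

lemma circ_eval:
  assumes "\<bar>p\<bar> \<le> n" "n > 0" "\<And>p. f (- p) = f p"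
  shows "circ n f p = min (f p) (f (n - \<bar>p\<bar>))"
proof -
  have nonneg: "circ n f p = min (f p) (f (n - p))" if "0 \<le> p" "p \<le> n" for p
  proof (cases "p = n")
    case True then show ?thesis using assms(2) assms(3)[of n] by (simp add: circ_def min.commute)
  next
    case False then show ?thesis using that assms(3)[of "n - p"] by (simp add: circ_range)
  qed
  then show ?thesis
    using nonneg[of p] nonneg[of "- p"] circ_minus[of n f p] assms by (cases "p \<ge> 0") auto
qed

text \<open>The other lift has \<open>3 * spoke\<close> at least its length plus 3; the constant 5
  adds the 2 that integer rounding allows.\<close>

lemma circ_spoke_eq:
  assumes "3 * spoke p \<le> n - \<bar>p\<bar> + 5" "\<bar>p\<bar> \<le> n" "n > 0"
  shows "circ n spoke p = spoke p"
  using assms spoke_lower[of "n - \<bar>p\<bar>"] by (simp add: circ_eval)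

lemma circ_inner_spoke: "\<bar>circ n inner p - circ n spoke p\<bar> \<le> 1"
  using inner_spoke[of "p mod n"] inner_spoke[of "p mod n - n"] unfolding circ_def by linarith

lemma circ_outer_large:
  assumes "3 \<le> p mod n" "p mod n \<le> n - 3"
  shows "circ n outer p = circ n spoke p + 1"
  using assms by (simp add: circ_def outer_large)

lemma circ_outer_eq:
  assumes "\<bar>p\<bar> \<le> n - 3" "circ n spoke p = spoke p"
  shows "circ n outer p = outer p"
proof -
  have "spoke p \<le> spoke (n - \<bar>p\<bar>)" using assms by (simp add: circ_eval)
  moreover have "outer (n - \<bar>p\<bar>) = spoke (n - \<bar>p\<bar>) + 1" using assms by (simp add: outer_large)
  ultimately show ?thesis
    using assms outer_spoke[of p] by (simp add: circ_eval)
qed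

lemma circ_outer_spoke: "\<bar>circ n outer p - circ n spoke p\<bar> \<le> 1"
  using outer_spoke[of "p mod n"] outer_spoke[of "p mod n - n"] unfolding circ_def by linarith

lemma circ_small:
  assumes "n \<ge> 8" "\<bar>x\<bar> \<le> 2"
  shows "circ n spoke x = spoke x" "circ n outer x = spoke x - 1"
proof -
  show *: "circ n spoke x = spoke x"
    using assms spoke_upper[of x] by (intro circ_spoke_eq) auto
  show "circ n outer x = spoke x - 1"
    using circ_outer_eq[OF _ *] outer_small[of x] assms by simp
qed

lemma circ_inner_le:
  assumes "\<bar>p\<bar> \<le> n" "n > 0"
  shows "circ n inner p \<le> inner p"
  using assms by (simp add: circ_eval)

lemma circ_cases:
  assumes "n \<ge> 8"
  obtains "circ n outer p = circ n spoke p + 1"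
  | x where "\<bar>x\<bar> \<le> 2" "p mod n = x mod n"
proof (cases "3 \<le> p mod n \<and> p mod n \<le> n - 3")
  case True then show thesis using that circ_outer_large by simp
next
  case False
  define q where "q = (if p mod n \<le> 2 then p mod n else p mod n - n)"
  have "0 \<le> p mod n" "p mod n < n" using assms by auto
  then have "\<bar>q\<bar> \<le> 2" "p mod n = q mod n" using False by (auto simp: q_def)
  then show thesis using that by blast
qed

text \<open>A condition under which the exceptional index \<open>x\<close>, paired with \<open>k = i - x\<close>, does no harm.\<close>
definition separated :: "int \<Rightarrow> int \<Rightarrow> int \<Rightarrow> bool" where
  "separated n x k \<longleftrightarrow> circ n spoke k \<ge> spoke x + 2 \<or>
     circ n spoke k \<ge> spoke x \<and> circ n inner k < circ n spoke k \<and> circ n spoke k < circ n outer k"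

lemma gain_nonpos_near:
  assumes "n \<ge> 8" "\<bar>x\<bar> \<le> 2" "separated n x (i - x)"
  shows "gain n i x \<le> 0"
  unfolding gain_def circ_small[OF assms(1,2)]
proof (rule excess_nonpos_near)
  show "circ n inner x \<le> spoke x + 1" "circ n inner (i - x) \<le> circ n spoke (i - x) + 1"
    "circ n spoke (i - x) - 1 \<le> circ n outer (i - x)"
    using circ_inner_spoke[of n x] circ_inner_spoke[of n "i - x"] circ_outer_spoke[of n "i - x"]
      circ_small[OF assms(1,2)] by auto
  show "spoke x + 2 \<le> circ n spoke (i - x) \<or> spoke x \<le> circ n spoke (i - x) \<and>
      circ n inner (i - x) < circ n spoke (i - x) \<and> circ n spoke (i - x) < circ n outer (i - x)"
    using assms(3) by (auto simp: separated_def)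
qed

text \<open>The window \<open>{-6..<n - 6}\<close> contains each residue once; starting at \<open>-6\<close> lets \<open>K\<close> consist of plain
  small integers, so that no reduction modulo \<open>n\<close> is needed when it is applied.\<close>
lemma double_bias_le:
  assumes n: "n \<ge> 9"
    and sep: "\<And>x. \<bar>x\<bar> \<le> 2 \<Longrightarrow> x \<in> K \<and> i - x \<in> K \<or> separated n x (i - x)"
    and K: "K \<subseteq> {-6..<n - 6}"
  shows "2 * bias n i \<le> (\<Sum>k\<in>K. gain n i k)"
proof -
  have nonpos: "gain n i j \<le> 0" if j: "j \<in> {-6..<n - 6}" "j \<notin> K" for j
  proof -
    have window: "j = k" if "j mod n = k mod n" "k \<in> K" for k
    proof -
      have "(j + 6) mod n = (k + 6) mod n" using that by (metis mod_add_cong)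
      moreover have "0 \<le> j + 6" "j + 6 < n" "0 \<le> k + 6" "k + 6 < n" using j K that by auto
      ultimately show ?thesis by (simp add: mod_pos_pos_trivial)
    qed
    have "n \<ge> 8" using n by simp
    \<comment> \<open>Either \<open>j\<close> is exceptional, or its mirror \<open>i - j\<close> is,
      or neither; \<open>gain_commute\<close> treats the second case like the first.\<close>
    consider x where "\<bar>x\<bar> \<le> 2" "j mod n = x mod n" | x where "\<bar>x\<bar> \<le> 2" "(i - j) mod n = x mod n"
      | "circ n outer j = circ n spoke j + 1" "circ n outer (i - j) = circ n spoke (i - j) + 1"
      using circ_cases[of n j] circ_cases[of n "i - j"] \<open>n \<ge> 8\<close> by metis
    then show ?thesis
    proof cases
      case 1
      then have "x \<notin> K" using window j by blast
      then have "separated n x (i - x)" using sep 1 by blast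
      then have "gain n i x \<le> 0" using gain_nonpos_near n 1 by simp
      then show ?thesis using gain_cong[OF refl 1(2), of i] by simp
    next
      case 2
      then have "(i - (i - j)) mod n = (i - x) mod n" by (metis mod_diff_cong)
      then have "i - x \<notin> K" using window[of "i - x"] j by auto
      then have "separated n x (i - x)" using sep 2 by blast
      then have "gain n i x \<le> 0" using gain_nonpos_near n 2 by simp
      then show ?thesis using gain_cong[OF refl 2(2), of i] gain_commute[of n i j] by simp
    next
      case 3
      then show ?thesis
        using excess_nonpos_far[of "circ n inner j" "circ n spoke j" "circ n inner (i - j)" "circ n spoke (i - j)"]
          circ_inner_spoke[of n j] circ_inner_spoke[of n "i - j"] by (simp add: gain_def)
    qed
  qed
  have "2 * bias n i = (\<Sum>j\<in>{-6..<n - 6}. gain n i j)"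
    using double_bias[of n i "-6"] n by simp
  also have "\<dots> = (\<Sum>j\<in>{-6..<n - 6} - K. gain n i j) + (\<Sum>j\<in>K. gain n i j)"
    using K by (simp add: sum.subset_diff)
  also have "\<dots> \<le> (\<Sum>j\<in>K. gain n i j)"
    using sum_nonpos[of "{-6..<n - 6} - K" "gain n i"] nonpos by auto
  finally show ?thesis .
qed

text \<open>The inner distances may come from the other lift, but \<open>excess\<close> is monotone
  in them, so an upper bound suffices.\<close>

lemma gain_le:
  assumes "n > 0"
    and "\<bar>j\<bar> \<le> n - 3" "3 * spoke j \<le> n - \<bar>j\<bar> + 5"
    and "\<bar>i - j\<bar> \<le> n - 3" "3 * spoke (i - j) \<le> n - \<bar>i - j\<bar> + 5"
  shows "gain n i j \<le> excess (outer j) (inner j) (spoke j) (outer (i - j)) (inner (i - j)) (spoke (i - j))"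
proof -
  have "circ n spoke j = spoke j" "circ n spoke (i - j) = spoke (i - j)"
    using assms by (simp_all add: circ_spoke_eq)
  moreover from this have "circ n outer j = outer j" "circ n outer (i - j) = outer (i - j)"
    using assms by (simp_all add: circ_outer_eq)
  ultimately show ?thesis
    unfolding gain_def using assms by (simp add: excess_mono circ_inner_le)
qed

text \<open>Split \<open>m\<close> into nearly equal \<open>p\<close> and \<open>q\<close> with
  \<open>p\<close> a multiple of 3, so that \<open>inner p\<close> is below \<open>spoke p\<close>.
  The choice depends on \<open>m mod 6\<close>; the residue 2 needs \<open>p = m div 2 + 2\<close>,
  whence the bound \<open>n - 6\<close>.\<close>

lemma gain_neg_midpoint:
  assumes "9 \<le> m" "m \<le> n - 6"
  obtains p where "3 \<le> p" "2 * p + 2 \<le> n" "gain n m p < 0"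
proof -
  have *: thesis
    if "3 \<le> p" "2 * p + 2 \<le> n" "3 \<le> q" "2 * q + 2 \<le> n" "m = p + q"
      "excess (spoke p + 1) (inner p) (spoke p) (spoke q + 1) (inner q) (spoke q) < 0" for p q
  proof -
    have "outer p = spoke p + 1" "outer q = spoke q + 1"
      using that by (simp_all add: outer_large)
    \<comment> \<open>With \<open>spoke_upper\<close>, \<open>2 * p + 2 <= n\<close> gives
      \<open>3 * spoke p <= p + 7 <= n - p + 5\<close>, as \<open>gain_le\<close> requires; likewise
      for \<open>q\<close>.\<close>
    then have "gain n m p < 0"
      using gain_le[of n p m] that spoke_upper[of p] spoke_upper[of q] by simp
    then show thesis using that \<open>\<And>p. 3 \<le> p \<Longrightarrow> 2 * p + 2 \<le> n \<Longrightarrow> gain n m p < 0 \<Longrightarrow> thesis\<close> by blast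
  qed
  define t where "t = m div 6"
  have "m = 6 * t + m mod 6" by (simp add: t_def)
  moreover have "0 \<le> m mod 6" "m mod 6 < 6" by simp_all
  then have "m mod 6 \<in> {0, 1, 2, 3, 4, 5}" by auto
  ultimately consider "m = 6 * t" | "m = 6 * t + 1" | "m = 6 * t + 2" | "m = 6 * t + 3"
    | "m = 6 * t + 4" | "m = 6 * t + 5" by (elim insertE emptyE) auto
  then show thesis
  proof cases
    case 1 then show ?thesis using assms
      by (intro *[of "3 * t" "3 * t"]) (simp_all add: third excess_def)
  next
    case 2 then show ?thesis using assms
      by (intro *[of "3 * t" "3 * t + 1"]) (simp_all add: third excess_def)
  next
    case 3 then show ?thesis using assms
      by (intro *[of "3 * t + 3" "3 * t - 1"]) (simp_all add: third excess_def)
  next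
    case 4 then show ?thesis using assms
      by (intro *[of "3 * t" "3 * t + 3"]) (simp_all add: third excess_def)
  next
    case 5 then show ?thesis using assms
      by (intro *[of "3 * t + 3" "3 * t + 1"]) (simp_all add: third excess_def)
  next
    case 6 then show ?thesis using assms
      by (intro *[of "3 * t + 3" "3 * t + 2"]) (simp_all add: third excess_def)
  qed
qed

subsection \<open>Negative bias at every distance\<close>

lemma small_values:
  "spoke 0 = 1" "spoke 1 = 2" "spoke 2 = 3" "spoke 3 = 2" "spoke 4 = 3" "spoke 5 = 4"
  "spoke 6 = 3" "spoke 7 = 4" "spoke 8 = 5" "spoke 9 = 4"
  "inner 0 = 0" "inner 1 = 3" "inner 2 = 4" "inner 3 = 1" "inner 4 = 4" "inner 5 = 5"
  "inner 6 = 2" "inner 7 = 5" "inner 8 = 6" "inner 9 = 3"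
  "outer 0 = 0" "outer 1 = 1" "outer 2 = 2" "outer 3 = 3" "outer 4 = 4" "outer 5 = 5"
  "outer 6 = 4" "outer 7 = 5" "outer 8 = 6" "outer 9 = 5"
  by (simp_all add: spoke_def inner_def outer_def)

text \<open>The bounds 9 and 4 satisfy \<open>3 * 4 <= 17 - 9 + 5\<close>, so \<open>gain_le\<close>
  applies for all these \<open>n\<close> at once.\<close>

lemma double_bias_le_excess:
  assumes n: "n \<ge> 17"
    and K: "\<And>k. k \<in> K \<Longrightarrow> - 6 \<le> k \<and> k \<le> 9 \<and> spoke k \<le> 4 \<and> \<bar>i - k\<bar> \<le> 9 \<and> spoke (i - k) \<le> 4"
    and near: "\<And>x. \<bar>x\<bar> \<le> 2 \<Longrightarrow> x \<in> K \<and> i - x \<in> K"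
  shows "2 * bias n i \<le> (\<Sum>k\<in>K. excess (outer k) (inner k) (spoke k) (outer (i - k)) (inner (i - k)) (spoke (i - k)))"
proof -
  have "2 * bias n i \<le> (\<Sum>k\<in>K. gain n i k)"
    using n K near by (intro double_bias_le) force+
  also have "\<dots> \<le> (\<Sum>k\<in>K. excess (outer k) (inner k) (spoke k) (outer (i - k)) (inner (i - k)) (spoke (i - k)))"
  proof (rule sum_mono)
    fix k assume "k \<in> K"
    from K[OF this] show "gain n i k \<le> excess (outer k) (inner k) (spoke k) (outer (i - k)) (inner (i - k)) (spoke (i - k))"
      using n by (intro gain_le) linarith+
  qed
  finally show ?thesis .
qed

lemma abs_le_2D: "\<bar>x :: int\<bar> \<le> 2 \<Longrightarrow> x \<in> {-2, -1, 0, 1, 2}"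
  by auto

lemma bias_neg_0:
  assumes "n \<ge> 17"
  shows "bias n 0 < 0"
proof -
  \<comment> \<open>The indices 1, 2 and their negatives contribute 4 each, 0 contributes 0, and the
    five nonzero multiples of 3 contribute -4 each.\<close>
  define K where "K = {-6, -3, -2, -1, 0, 1, 2, 3, 6, 9 :: int}"
  have "2 * bias n 0 \<le> (\<Sum>k\<in>K. excess (outer k) (inner k) (spoke k) (outer (0 - k)) (inner (0 - k)) (spoke (0 - k)))"
    using assms by (rule double_bias_le_excess) (auto simp: K_def small_values dest!: abs_le_2D)
  also have "\<dots> < 0"
    by (simp add: K_def excess_def small_values)
  finally show ?thesis by simp
qed

lemma bias_neg_3:
  assumes "n \<ge> 17"
  shows "bias n 3 < 0"
proof -
  \<comment> \<open>\<open>K\<close> is closed under \<open>k\<close> to \<open>3 - k\<close>. The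
    pairs -6, 9 and -3, 6 give -4 each and 0, 3 gives -2, against 8 from the other three
    pairs.\<close>
  define K where "K = {-6, -3, -2, -1, 0, 1, 2, 3, 4, 5, 6, 9 :: int}"
  have "2 * bias n 3 \<le> (\<Sum>k\<in>K. excess (outer k) (inner k) (spoke k) (outer (3 - k)) (inner (3 - k)) (spoke (3 - k)))"
    using assms by (rule double_bias_le_excess) (auto simp: K_def small_values dest!: abs_le_2D)
  also have "\<dots> < 0"
    by (simp add: K_def excess_def small_values)
  finally show ?thesis by simp
qed

section \<open>The distances 3 and 4\<close>

lemma separatedI_far: "circ n spoke k \<ge> spoke x + 2 \<Longrightarrow> separated n x k"
  by (simp add: separated_def)

lemma circ_at_6_9:
  assumes "n \<ge> 17" "\<bar>k\<bar> \<in> {6, 9}"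
  shows "circ n inner k < circ n spoke k" "circ n spoke k < circ n outer k"
    "circ n spoke k = spoke k"
proof -
  have "k \<in> {-9, -6, 6, 9}" using assms by auto
  then have "3 dvd k" "3 * spoke k \<le> n - \<bar>k\<bar> + 5" using assms by (auto simp: spoke_def)
  moreover show *: "circ n spoke k = spoke k"
    using calculation assms by (intro circ_spoke_eq) auto
  moreover have "circ n outer k = outer k"
    using * assms by (intro circ_outer_eq) auto
  ultimately show "circ n inner k < circ n spoke k" "circ n spoke k < circ n outer k"
    using assms circ_inner_le[of k n] outer_large[of k] by (auto simp: inner_def)
qed

text \<open>For \<open>n = 17\<close> the index -8 is also 9, at spoke distance only 4, so 2 needs
  the second alternative of \<open>separated\<close>.\<close>

lemma separated_8:
  assumes "n \<ge> 17"
  shows "separated n 1 (- 8)" "separated n 2 (- 8)"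
proof -
  have circ: "circ n spoke (- 8) = min 5 (spoke (n - 8))" "circ n outer (- 8) = min 6 (spoke (n - 8) + 1)"
    "circ n inner (- 8) = min 6 (inner (n - 8))"
    using assms by (simp_all add: circ_eval outer_large) (simp_all add: spoke_def inner_def)
  have small: "spoke 1 = 2" "spoke 2 = 3" by (simp_all add: spoke_def)
  show "separated n 1 (- 8)"
    using assms spoke_lower[of "n - 8"] by (simp add: separated_def circ small)
  show "separated n 2 (- 8)"
  proof (cases "n = 17")
    case True
    then show ?thesis by (simp add: separated_def circ_eval small) (simp add: spoke_def inner_def outer_def)
  next
    case False
    then show ?thesis using assms spoke_lower[of "n - 8"] by (simp add: separated_def circ small)
  qed
qed

lemma bias_neg_6:
  assumes "n \<ge> 17"
  shows "bias n (- 6) < 0"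
proof -
  obtain p where p: "3 \<le> p" "2 * p + 2 \<le> n" "gain n (n - 6) p < 0"
    using gain_neg_midpoint[of "n - 6" n] assms by auto
  \<comment> \<open>On the short arc the exceptional pair -2, -4 gives 4 in total and the midpoint
    -3 gives -4; the midpoint \<open>p\<close> of the long arc makes the sum negative.\<close>
  define K where "K = {-4, -3, -2, p}"
  have "2 * bias n (- 6) \<le> (\<Sum>k\<in>K. gain n (- 6) k)"
  proof (rule double_bias_le)
    fix x :: int assume "\<bar>x\<bar> \<le> 2"
    then have "x \<in> {-2, -1, 0, 1, 2}" by auto
    moreover have "circ n spoke (- 5) = 4" "circ n spoke (- 6) = 3" "circ n spoke (- 7) = 4"
      using assms circ_spoke_eq[of "-5" n] circ_spoke_eq[of "-6" n] circ_spoke_eq[of "-7" n]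
      by (simp_all add: spoke_def)
    ultimately show "x \<in> K \<and> - 6 - x \<in> K \<or> separated n x (- 6 - x)"
      using separated_8[OF assms] separatedI_far[of x n "- 6 - x"]
      by (auto simp: K_def spoke_def)
  qed (use assms p in \<open>auto simp: K_def\<close>)
  also have "\<dots> = gain n (- 6) (-4) + gain n (- 6) (-3) + gain n (- 6) (-2) + gain n (- 6) p"
    using p by (simp add: K_def)
  also have "gain n (- 6) p = gain n (n - 6) p"
    by (rule gain_cong) simp_all
  also have "gain n (- 6) (-4) + gain n (- 6) (-3) + gain n (- 6) (-2) \<le> 0"
    using gain_le[of n "-4" "-6"] gain_le[of n "-3" "-6"] gain_le[of n "-2" "-6"] assms
    by (simp add: excess_def outer_def inner_def spoke_def)
  finally show ?thesis using p by simp
qed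

lemma bias_neg_7:
  assumes "n \<ge> 17"
  shows "bias n (- 7) < 0"
proof -
  obtain p where p: "3 \<le> p" "2 * p + 2 \<le> n" "gain n (n - 7) p < 0"
    using gain_neg_midpoint[of "n - 7" n] assms by auto
  \<comment> \<open>The pair -2, -5 gives 2 and the pair -3, -4 gives -2, so again \<open>p\<close>
    decides.\<close>
  define K where "K = {-5, -4, -3, -2, p}"
  have "2 * bias n (- 7) \<le> (\<Sum>k\<in>K. gain n (- 7) k)"
  proof (rule double_bias_le)
    fix x :: int assume "\<bar>x\<bar> \<le> 2"
    then have "x \<in> {-2, -1, 0, 1, 2}" by auto
    moreover have "circ n spoke (- 7) = 4"
      using assms circ_spoke_eq[of "-7" n] by (simp add: spoke_def)
    moreover have "separated n (- 1) (- 6)" "separated n 2 (- 9)"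
      using circ_at_6_9[OF assms, of "-6"] circ_at_6_9[OF assms, of "-9"]
      by (simp_all add: separated_def) (simp_all add: spoke_def)
    ultimately show "x \<in> K \<and> - 7 - x \<in> K \<or> separated n x (- 7 - x)"
      using separated_8[OF assms] separatedI_far[of x n "- 7 - x"]
      by (auto simp: K_def spoke_def)
  qed (use assms p in \<open>auto simp: K_def\<close>)
  also have "\<dots> = gain n (- 7) (-5) + gain n (- 7) (-4) + gain n (- 7) (-3) + gain n (- 7) (-2) + gain n (- 7) p"
    using p by (simp add: K_def)
  also have "gain n (- 7) p = gain n (n - 7) p"
    by (rule gain_cong) simp_all
  also have "gain n (- 7) (-5) + gain n (- 7) (-4) + gain n (- 7) (-3) + gain n (- 7) (-2) \<le> 0"
    using gain_le[of n "-5" "-7"] gain_le[of n "-4" "-7"] gain_le[of n "-3" "-7"] gain_le[of n "-2" "-7"] assms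
    by (simp add: excess_def outer_def inner_def spoke_def)
  finally show ?thesis using p by simp
qed

text \<open>Unless \<open>q\<close> is a multiple of 3, moving by 2 never increases
  \<open>spoke\<close>.\<close>

lemma inner_less_spoke_of_step2:
  assumes "spoke q \<le> 4" "\<bar>x\<bar> = 2" "spoke (q + x) \<ge> 5"
  shows "inner q < spoke q"
proof -
  have "x = 2 \<or> x = - 2" using assms(2) by linarith
  then show ?thesis
    using assms(1,3) by (cases rule: third_cases[of q]) (auto simp: third abs_if split: if_splits)
qed

text \<open>At spoke distance 5 or more every exceptional index is separated from its mirror, so the
  midpoint alone forms \<open>K\<close>.\<close>

lemma bias_neg_far:
  assumes "n \<ge> 17" "9 \<le> i" "i \<le> n - 6" "circ n spoke i \<ge> 5"
  shows "bias n i < 0"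
proof -
  obtain p where p: "3 \<le> p" "2 * p + 2 \<le> n" "gain n i p < 0"
    using gain_neg_midpoint[of i n] assms by auto
  have "2 * bias n i \<le> (\<Sum>k\<in>{p}. gain n i k)"
  proof (rule double_bias_le)
    fix x :: int assume x: "\<bar>x\<bar> \<le> 2"
    have n: "n \<ge> 8" using assms by simp
    \<comment> \<open>A lift of \<open>i - x\<close> that realises its spoke distance; shifting it
      by \<open>x\<close> bounds the spoke distance of \<open>i\<close>.\<close>
    obtain q where q: "circ n spoke (i - x) = spoke q" "circ n inner (i - x) \<le> inner q" "circ n spoke i \<le> spoke (q + x)"
    proof -
      obtain q where "cdist n False True (i - x) = zdist False True q"
        and le: "\<And>a b s. \<bar>s\<bar> \<le> 3 \<Longrightarrow> cdist n a b (i - x + s) \<le> zdist a b (q + s)"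
        using cdist_attained[OF n, of "i - x" False True] by metis
      then show thesis
        using that[of q] le[of 0 True True] le[of x False True] x by (simp add: cdist_def zdist_def)
    qed
    have "separated n x (i - x)"
    proof (cases "\<bar>x\<bar> = 2")
      case True
      have "circ n outer (i - x) = circ n spoke (i - x) + 1"
        using x assms by (intro circ_outer_large) (auto simp: mod_pos_pos_trivial)
      moreover have "x = 2 \<or> x = - 2" using True by linarith
      then have "spoke x = 3" "\<bar>spoke (q + x) - spoke q\<bar> \<le> 2"
        using spoke_step1[of q] spoke_step1[of "q + 1"] spoke_step1[of "q - 1"] spoke_step1[of "q - 2"]
        by (elim disjE; simp add: small_values add.commute; linarith)+
      ultimately show ?thesis
        using q inner_less_spoke_of_step2[OF _ True, of q] assms(4) unfolding separated_def by linarith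
    next
      case False
      then have "x \<in> {-1, 0, 1}" using x by auto
      then have "spoke q \<ge> spoke x + 2"
        using q assms(4) spoke_step1[of q] spoke_step1[of "q - 1"] by (auto simp: small_values)
      then show ?thesis using q by (simp add: separated_def)
    qed
    then show "x \<in> {p} \<and> i - x \<in> {p} \<or> separated n x (i - x)" ..
  qed (use assms p in auto)
  then show ?thesis using p by simp
qed

text \<open>Distances 1 to 4 use the indices 0, 3, \<open>n - 6\<close> and \<open>n - 7\<close>;
  larger ones use \<open>bias_neg_far\<close>.\<close>

lemma exists_bias_neg:
  assumes "n \<ge> 17" "1 \<le> l" "0 \<le> m" "m < n" "l \<le> circ n spoke m"
  obtains i where "0 \<le> i" "i < n" "circ n spoke i = l" "bias n i < 0"
proof -
  have val: "circ n spoke i = spoke i" if "i \<in> {0, 3, 6, 7}" for i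
    using that assms(1) by (intro circ_spoke_eq) (auto simp: spoke_def)
  have spoke: "spoke 0 = 1" "spoke 3 = 2" "spoke 6 = 3" "spoke 7 = 4" by (simp_all add: spoke_def)
  have reflect: "circ n spoke (n - i) = circ n spoke i" "bias n (n - i) = bias n (- i)" for i
    using circ_minus[of n spoke i] circ_shift(2)[of n spoke "- i"] assms(1)
      bias_mod[of n "n - i"] bias_mod[of n "- i"] by auto
  consider "l = 1" | "l = 2" | "l = 3" | "l = 4" | "l \<ge> 5" using assms(2) by linarith
  then show thesis
  proof cases
    case 1 then show ?thesis using that[of 0] bias_neg_0 val[of 0] spoke assms(1) by simp
  next
    case 2 then show ?thesis using that[of 3] bias_neg_3 val[of 3] spoke assms(1) by simp
  next
    case 3 then show ?thesis using that[of "n - 6"] bias_neg_6 val[of 6] spoke assms(1) reflect by simp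
  next
    case 4 then show ?thesis using that[of "n - 7"] bias_neg_7 val[of 7] spoke assms(1) reflect by simp
  next
    case 5
    have n: "n \<ge> 8" using assms(1) by simp
    have step: "\<bar>circ n spoke (int (Suc k)) - circ n spoke (int k)\<bar> \<le> 1" for k
    proof -
      have "cdist n True False (int k + 1) \<le> cdist n True False (int k) + 1"
        using cdist_cycle_step(1)[OF n, of 1 False True "int k"] by simp
      moreover have "cdist n True False (int k) \<le> cdist n True False (int k + 1) + 1"
        using cdist_cycle_step(2)[OF n, of 1 False True "int k + 1"] by simp
      ultimately show ?thesis by (simp add: cdist_def zdist_def add.commute)
    qed
    \<comment> \<open>Discrete intermediate value theorem between 0, where the spoke distance is 1,
      and \<open>m\<close>.\<close>
    have "\<exists>k. k \<le> nat m \<and> circ n spoke (int k) = l"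
      using step assms 5 val[of 0] spoke by (intro nat0_intermed_int_val) auto
    then obtain k where "k \<le> nat m" "circ n spoke (int k) = l" by blast
    then obtain i where i: "0 \<le> i" "i \<le> m" "circ n spoke i = l"
      using assms that[of "int k"] by (metis le_nat_iff of_nat_0_le_iff)
    then have "l \<le> spoke i" "l \<le> spoke (n - i)" using assms circ_eval[of i n spoke] by auto
    then have "8 \<le> i" "i \<le> n - 8" using 5 i assms spoke_upper[of i] spoke_upper[of "n - i"] by auto
    \<comment> \<open>The index 8 is too small for \<open>bias_neg_far\<close> and is replaced by
      its mirror \<open>n - 8\<close>, which is at least 9 precisely from \<open>n = 17\<close>
      on.\<close>
    then show ?thesis
      using that[of i] that[of "n - 8"] i 5 assms(1) bias_neg_far[of n i] bias_neg_far[of n "n - 8"] reflect[of 8]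
      by (cases "i = 8") auto
  qed
qed

section \<open>The diameter and the result for n > 16\<close>

lemma finite_gdist_gp: "finite {gdist (gp_adj n k) x y | x y. x \<in> gp_verts n \<and> y \<in> gp_verts n}"
proof -
  have "{gdist (gp_adj n k) x y | x y. x \<in> gp_verts n \<and> y \<in> gp_verts n} =
    (\<lambda>(x, y). gdist (gp_adj n k) x y) ` (gp_verts n \<times> gp_verts n)" by auto
  then show ?thesis using finite_gp_verts by simp
qed

text \<open>Distances within one kind exceed the spoke distance of the same index by at most 1, so
  each distance below the diameter is at most some spoke distance.\<close>

lemma gdiam_gp_le:
  assumes "n \<ge> 8"
  obtains m where "0 \<le> m" "m < int n" "int (gdiam (gp_verts n) (gp_adj n 3)) \<le> circ (int n) spoke m + 1"
proof -
  have "(False, 0) \<in> gp_verts n" using assms by (simp add: gp_verts_def)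
  then have "gdiam (gp_verts n) (gp_adj n 3) \<in> {gdist (gp_adj n 3) x y | x y. x \<in> gp_verts n \<and> y \<in> gp_verts n}"
    unfolding gdiam_def by (intro Max_in finite_gdist_gp) blast
  then obtain a i b j where "i < n" "j < n" "gdiam (gp_verts n) (gp_adj n 3) = gdist (gp_adj n 3) (a, i) (b, j)"
    by (auto simp: gp_verts_def)
  then have "int (gdiam (gp_verts n) (gp_adj n 3)) = cdist (int n) a b (int j - int i)"
    using gdist_gp assms by simp
  also have "\<dots> \<le> circ (int n) spoke (int j - int i) + 1"
    using circ_inner_spoke[of "int n" "int j - int i"] circ_outer_spoke[of "int n" "int j - int i"]
    by (auto simp: cdist_def zdist_def)
  finally show thesis using that[of "(int j - int i) mod int n"] assms by simp
qed

lemma gp3_not_ldb_below_diam: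
  assumes "n > 16"
  shows "gp_not_ldb_below_diam n 3"
  unfolding gp_not_ldb_below_diam_def
proof (intro allI impI)
  fix l assume l: "1 \<le> l \<and> l < gdiam (gp_verts n) (gp_adj n 3)"
  have n: "n \<ge> 8" using assms by simp
  obtain m where "0 \<le> m" "m < int n" "int (gdiam (gp_verts n) (gp_adj n 3)) \<le> circ (int n) spoke m + 1"
    using gdiam_gp_le[OF n] .
  then obtain i where "0 \<le> i" "i < int n" "circ (int n) spoke i = int l" "bias (int n) i < 0"
    using exists_bias_neg[of "int n" "int l" m] assms l by auto
  then show "\<not> dist_balanced (gp_verts n) (gp_adj n 3) l"
    using not_dist_balancedI n by simp
qed

subsection \<open>The case n = 16\<close>

lemma below_16: "{0..<16 :: int} = {0, 1, 2, 3, 4, 5, 6, 7, 8, 9, 10, 11, 12, 13, 14, 15}"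
proof -
  have "{0..<16 :: int} = set [0..15]" by auto
  then show ?thesis by (simp add: upto_rec1 del: set_upto)
qed

lemma circ_16_values:
  "circ 16 spoke 0 = 1" "circ 16 spoke 1 = 2" "circ 16 spoke 2 = 3" "circ 16 spoke 3 = 2"
  "circ 16 spoke 4 = 3" "circ 16 spoke 5 = 4" "circ 16 spoke 6 = 3" "circ 16 spoke 7 = 4"
  "circ 16 spoke 8 = 5" "circ 16 spoke 9 = 4" "circ 16 spoke 10 = 3" "circ 16 spoke 11 = 4"
  "circ 16 spoke 12 = 3" "circ 16 spoke 13 = 2" "circ 16 spoke 14 = 3" "circ 16 spoke 15 = 2"
  "circ 16 inner 0 = 0" "circ 16 inner 1 = 3" "circ 16 inner 2 = 4" "circ 16 inner 3 = 1"
  "circ 16 inner 4 = 4" "circ 16 inner 5 = 5" "circ 16 inner 6 = 2" "circ 16 inner 7 = 3"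
  "circ 16 inner 8 = 6"
  "circ 16 outer 0 = 0" "circ 16 outer 1 = 1" "circ 16 outer 2 = 2" "circ 16 outer 3 = 3"
  "circ 16 outer 4 = 4" "circ 16 outer 5 = 5" "circ 16 outer 6 = 4" "circ 16 outer 7 = 5"
  "circ 16 outer 8 = 6" "circ 16 outer 9 = 5" "circ 16 outer 10 = 4" "circ 16 outer 11 = 5"
  "circ 16 outer 12 = 4" "circ 16 outer 13 = 3" "circ 16 outer 14 = 2" "circ 16 outer 15 = 1"
  by (simp_all add: circ_def spoke_def inner_def outer_def)

lemma bias_16_8: "bias 16 8 = 0"
proof -
  \<comment> \<open>The arguments \<open>8 - j\<close> run from 8 down to -7; evenness brings them
    to the tabulated range.\<close>
  have "circ 16 spoke (- p) = circ 16 spoke p" "circ 16 inner (- p) = circ 16 inner p" for p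
    by (simp_all add: circ_minus)
  then show ?thesis by (simp add: bias_def below_16 circ_16_values)
qed

lemma circ_spoke_16:
  assumes "circ 16 spoke p = 5"
  shows "p mod 16 = 8"
proof -
  have "p mod 16 \<in> {0..<16}" by simp
  then show ?thesis using assms unfolding below_16
    by (elim insertE emptyE) (simp_all add: circ_def spoke_def)
qed

text \<open>Pairs of one kind are balanced by reflection; a mixed pair at distance 5 has index
  difference 8 modulo 16, where the bias vanishes.\<close>

lemma dist_balanced_gp_16: "dist_balanced (gp_verts 16) (gp_adj 16 3) 5"
  unfolding dist_balanced_def
proof (intro ballI impI)
  fix x y
  assume xy: "x \<in> gp_verts 16" "y \<in> gp_verts 16" and dist: "gdist (gp_adj 16 3) x y = 5"
  obtain a i b j where v: "x = (a, i)" "y = (b, j)" "i < 16" "j < 16"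
    using xy by (cases x, cases y) (auto simp: gp_verts_def)
  have d: "cdist 16 a b (int j - int i) = 5"
    using gdist_gp[of 16 i j a b] dist v by simp
  have mixed: "card (Wset (gp_verts 16) (gp_adj 16 3) (False, i) (True, j)) =
      card (Wset (gp_verts 16) (gp_adj 16 3) (True, j) (False, i))"
    if "i < 16" "j < 16" "circ 16 spoke (int j - int i) = 5" for i j
  proof -
    have "bias 16 (int j - int i) = bias 16 8"
      using circ_spoke_16[OF that(3)] bias_mod[of 16 "int j - int i"] by simp
    then show ?thesis using card_Wset_diff_mixed[of 16 i j] that bias_16_8 by simp
  qed
  show "card (Wset (gp_verts 16) (gp_adj 16 3) x y) = card (Wset (gp_verts 16) (gp_adj 16 3) y x)"
  proof (cases "a = b")
    case True
    then show ?thesis using card_Wset_same_kind[of 16 i j a] v by simp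
  next
    case False
    then have c: "circ 16 spoke (int j - int i) = 5" "circ 16 spoke (int i - int j) = 5"
      using d circ_minus[of 16 spoke "int i - int j"] by (auto simp: cdist_def zdist_def)
    show ?thesis
      using mixed[OF v(3,4) c(1)] mixed[OF v(4,3) c(2)] v False by (cases a; cases b) auto
  qed
qed

text \<open>The vertices \<open>u_0\<close> and \<open>u_8\<close> are at distance 6, so 5 lies
  strictly below the diameter.\<close>

lemma gdiam_gp_16: "gdiam (gp_verts 16) (gp_adj 16 3) \<ge> 6"
proof -
  have "int (gdist (gp_adj 16 3) (False, 0) (False, 8)) = 6"
    using gdist_gp[of 16 0 8 False False]
    by (simp add: cdist_def zdist_def circ_def outer_def spoke_def)
  moreover have "(False, 0) \<in> gp_verts 16" "(False, 8) \<in> gp_verts 16"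
    by (simp_all add: gp_verts_def)
  then have "gdist (gp_adj 16 3) (False, 0) (False, 8) \<le> gdiam (gp_verts 16) (gp_adj 16 3)"
    unfolding gdiam_def by (intro Max_ge[OF finite_gdist_gp]) blast
  ultimately show ?thesis by linarith
qed

theorem theorem1p3:
  shows "(\<forall>n::nat. n > 16 \<longrightarrow> gp_not_ldb_below_diam n 3) \<and>
         (\<forall>N::nat. (\<forall>n::nat. n > N \<and> 2 * 3 < n \<longrightarrow> gp_not_ldb_below_diam n 3) \<longrightarrow> 16 \<le> N)"
proof (intro conjI allI impI)
  fix n :: nat assume "n > 16"
  then show "gp_not_ldb_below_diam n 3" by (rule gp3_not_ldb_below_diam)
next
  fix N :: nat
  assume N: "\<forall>n::nat. n > N \<and> 2 * 3 < n \<longrightarrow> gp_not_ldb_below_diam n 3"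
  have "\<not> gp_not_ldb_below_diam 16 3"
    using dist_balanced_gp_16 gdiam_gp_16 unfolding gp_not_ldb_below_diam_def
    by (intro notI) (auto dest!: spec[of _ 5])
  then show "16 \<le> N" using N by (intro leI notI) simp
qed

end
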